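(* Let $(\Omega,\mathcal{F},P)$ be a probability space with a filtration $(\mathcal{G}_t)_{t\ge0}$ and let $S$ be a $(\mathcal{G}_t)$-semimartingale. Then $S$ satisfies (NA1) under $(\mathcal{G}_t)$ if and only if there exists an unbounded increasing function $U:[0,\infty)\to\mathbb{R}$ such that the maximal expected utility is finite, i.e. such that $$\sup_{X\in\mathcal{K}_1(\mathcal{G}_t)}E(U(X))<\infty.$$
   Context: In the paper $(\mathcal{G}_t)$ is an enlargement of a smaller filtration $(\mathcal{F}_t)$. A $(\mathcal{G}_t)$-strategy is a $(\mathcal{G}_t)$-predictable process $H$ (with values in $\mathbb{R}^d$ if $S$ is $d$-dimensional); it is 1-admissible if the stochastic integral $H\cdot S=\int_0^\cdot H_s\cdot dS_s$ exists and $P((H\cdot S)_t\ge-1)=1$ for all $t\ge0$. $\mathcal{K}_1(\mathcal{G}_t)$ is the set of terminal wealths $1+(H\cdot S)_\infty$, where $H$ runs through all 1-admissible $(\mathcal{G}_t)$-strategies for which $(H\cdot S)_t$ converges a.s. as $t\to\infty$. $S$ satisfies (NA1) under $(\mathcal{G}_t)$ if $\mathcal{K}_1(\mathcal{G}_t)$ is bounded in probability, i.e. $\lim_{M\to\infty}\sup_{X\in\mathcal{K}_1(\mathcal{G}_t)}P(|X|\ge M)=0$. *)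

theory Defs
  imports "HOL-Probability.Probability"
begin

text \<open>
  Time runs through \<open>[0, \<infinity>)\<close>, represented by the type \<^typ>\<open>real\<close>. Nothing below depends on a
  process or on the \<open>\<sigma>\<close>-algebras \<open>G t\<close> at negative times, except that stopping times are required
  to be nonnegative, so that the event \<open>{T \<le> t}\<close> is empty for \<open>t < 0\<close>. A filtration on \<open>[0, \<infinity>)\<close> is
  extended to negative times by \<open>G t = G 0\<close>. Neither right-continuity nor completeness is assumed.
\<close>

section \<open>Semimartingales\<close>

definition adapted :: "(real \<Rightarrow> 'a measure) \<Rightarrow> (real \<Rightarrow> 'a \<Rightarrow> 'b::topological_space) \<Rightarrow> bool" where
  "adapted G X \<longleftrightarrow> (\<forall>t\<ge>0. X t \<in> borel_measurable (G t))"

definition cadlag :: "(real \<Rightarrow> 'b::topological_space) \<Rightarrow> bool" where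
  "cadlag f \<longleftrightarrow> (\<forall>t\<ge>0. (f \<longlongrightarrow> f t) (at_right t)) \<and> (\<forall>t>0. \<exists>l. (f \<longlongrightarrow> l) (at_left t))"

definition cadlag_process :: "'a measure \<Rightarrow> (real \<Rightarrow> 'a \<Rightarrow> 'b::topological_space) \<Rightarrow> bool" where
  "cadlag_process M X \<longleftrightarrow>
     (\<forall>t\<ge>0. X t \<in> borel_measurable M) \<and> (\<forall>\<omega>\<in>space M. cadlag (\<lambda>t. X t \<omega>))"

definition martingale :: "'a measure \<Rightarrow> (real \<Rightarrow> 'a measure) \<Rightarrow> (real \<Rightarrow> 'a \<Rightarrow> real) \<Rightarrow> bool" where
  "martingale M G X \<longleftrightarrow> adapted G X \<and> (\<forall>t\<ge>0. integrable M (X t)) \<and>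
     (\<forall>s t. 0 \<le> s \<and> s \<le> t \<longrightarrow> (AE \<omega> in M. real_cond_exp M (G s) (X t) \<omega> = X s \<omega>))"

text \<open>
  Finite stopping times suffice as localizing times: replace \<open>T n\<close> by \<open>min (T n) n\<close>.
\<close>

definition local_martingale :: "'a measure \<Rightarrow> (real \<Rightarrow> 'a measure) \<Rightarrow> (real \<Rightarrow> 'a \<Rightarrow> real) \<Rightarrow> bool" where
  "local_martingale M G X \<longleftrightarrow> adapted G X \<and> cadlag_process M X \<and>
     (\<exists>T :: nat \<Rightarrow> 'a \<Rightarrow> real.
        (\<forall>n. stopping_time G (T n)) \<and>
        (\<forall>n \<omega>. 0 \<le> T n \<omega> \<and> T n \<omega> \<le> T (Suc n) \<omega>) \<and>
        (AE \<omega> in M. filterlim (\<lambda>n. T n \<omega>) at_top sequentially) \<and>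
        (\<forall>n. martingale M G (\<lambda>t \<omega>. X (min t (T n \<omega>)) \<omega>)))"

definition finite_variation :: "(real \<Rightarrow> real) \<Rightarrow> bool" where
  "finite_variation f \<longleftrightarrow>
     (\<forall>T\<ge>0. \<exists>C. \<forall>(n::nat) \<tau>. mono \<tau> \<and> range \<tau> \<subseteq> {0..T} \<longrightarrow>
        (\<Sum>i<n. \<bar>f (\<tau> (Suc i)) - f (\<tau> i)\<bar>) \<le> C)"

definition finite_variation_process ::
    "'a measure \<Rightarrow> (real \<Rightarrow> 'a measure) \<Rightarrow> (real \<Rightarrow> 'a \<Rightarrow> real) \<Rightarrow> bool" where
  "finite_variation_process M G A \<longleftrightarrow> adapted G A \<and> cadlag_process M A \<and>
     (\<forall>\<omega>\<in>space M. finite_variation (\<lambda>t. A t \<omega>))"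

definition semimartingale ::
    "'a measure \<Rightarrow> (real \<Rightarrow> 'a measure) \<Rightarrow> (real \<Rightarrow> 'a \<Rightarrow> 'b::euclidean_space) \<Rightarrow> bool" where
  "semimartingale M G S \<longleftrightarrow> adapted G S \<and> cadlag_process M S \<and>
     (\<forall>b\<in>Basis. \<exists>N A. local_martingale M G N \<and> finite_variation_process M G A \<and>
        (\<forall>\<omega>\<in>space M. N 0 \<omega> = 0 \<and> A 0 \<omega> = 0) \<and>
        (AE \<omega> in M. \<forall>t\<ge>0. S t \<omega> \<bullet> b = S 0 \<omega> \<bullet> b + N t \<omega> + A t \<omega>))"

section \<open>Predictable and simple integrands\<close>

definition predictable_sigma :: "'a measure \<Rightarrow> (real \<Rightarrow> 'a measure) \<Rightarrow> (real \<times> 'a) measure" where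
  "predictable_sigma M G = sigma ({0..} \<times> space M)
     ({{0} \<times> A | A. A \<in> sets (G 0)} \<union>
      {{s<..t} \<times> A | s t A. 0 \<le> s \<and> s \<le> t \<and> A \<in> sets (G s)})"

definition predictable ::
    "'a measure \<Rightarrow> (real \<Rightarrow> 'a measure) \<Rightarrow> (real \<Rightarrow> 'a \<Rightarrow> 'b::topological_space) \<Rightarrow> bool" where
  "predictable M G H \<longleftrightarrow> (\<lambda>(t, \<omega>). H t \<omega>) \<in> borel_measurable (predictable_sigma M G)"

text \<open>The data \<open>(n, \<tau>, h)\<close> encode the process \<open>\<Sum>i<n. h\<^sub>i 1\<^bsub>(\<tau>\<^sub>i, \<tau>\<^sub>i\<^sub>+\<^sub>1]\<^esub>\<close>.\<close>

definition simple_integrand ::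
    "'a measure \<Rightarrow> (real \<Rightarrow> 'a measure) \<Rightarrow> nat \<Rightarrow> (nat \<Rightarrow> real) \<Rightarrow>
     (nat \<Rightarrow> 'a \<Rightarrow> 'b::euclidean_space) \<Rightarrow> bool" where
  "simple_integrand M G n \<tau> h \<longleftrightarrow> 0 \<le> \<tau> 0 \<and> mono \<tau> \<and>
     (\<forall>i<n. h i \<in> borel_measurable (G (\<tau> i))) \<and>
     (\<exists>c. \<forall>i<n. \<forall>\<omega>\<in>space M. norm (h i \<omega>) \<le> c)"

definition simple_process ::
    "nat \<Rightarrow> (nat \<Rightarrow> real) \<Rightarrow> (nat \<Rightarrow> 'a \<Rightarrow> 'b::euclidean_space) \<Rightarrow> real \<Rightarrow> 'a \<Rightarrow> 'b" where
  "simple_process n \<tau> h t \<omega> = (\<Sum>i<n. indicator {\<tau> i<..\<tau> (Suc i)} t *\<^sub>R h i \<omega>)"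

definition simple_integral ::
    "nat \<Rightarrow> (nat \<Rightarrow> real) \<Rightarrow> (nat \<Rightarrow> 'a \<Rightarrow> 'b::euclidean_space) \<Rightarrow>
     (real \<Rightarrow> 'a \<Rightarrow> 'b) \<Rightarrow> real \<Rightarrow> 'a \<Rightarrow> real" where
  "simple_integral n \<tau> h S t \<omega> =
     (\<Sum>i<n. h i \<omega> \<bullet> (S (min t (\<tau> (Suc i))) \<omega> - S (min t (\<tau> i)) \<omega>))"

section \<open>Modes of convergence of processes\<close>

definition sup_size :: "'a measure \<Rightarrow> real \<Rightarrow> (real \<Rightarrow> 'a \<Rightarrow> real) \<Rightarrow> ennreal" where
  "sup_size M T X = (\<integral>\<^sup>+ \<omega>. min 1 (SUP t\<in>{0..T}. ennreal \<bar>X t \<omega>\<bar>) \<partial>M)"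

text \<open>Uniform convergence on compact time intervals, in probability.\<close>

definition ucp_tendsto ::
    "'a measure \<Rightarrow> (nat \<Rightarrow> real \<Rightarrow> 'a \<Rightarrow> real) \<Rightarrow> (real \<Rightarrow> 'a \<Rightarrow> real) \<Rightarrow> bool" where
  "ucp_tendsto M Xs X \<longleftrightarrow>
     (\<forall>T\<ge>0. (\<lambda>n. sup_size M T (\<lambda>t \<omega>. Xs n t \<omega> - X t \<omega>)) \<longlonglongrightarrow> 0)"

text \<open>
  Emery's semimartingale topology, given by \<open>E (1 \<and> sup\<^sub>t\<^sub>\<le>\<^sub>T \<bar>X\<^sub>0 + (K \<bullet> X)\<^sub>t\<bar>)\<close> for all \<open>T\<close>, uniformly in
  the integrands \<open>K\<close> with \<open>\<bar>K\<bar> \<le> 1\<close>. Restricting \<open>K\<close> to simple integrands does not change the supremum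
  when \<open>X\<close> is a semimartingale, and keeps the definition independent of the general integral.
\<close>

definition emery_size ::
    "'a measure \<Rightarrow> (real \<Rightarrow> 'a measure) \<Rightarrow> real \<Rightarrow> (real \<Rightarrow> 'a \<Rightarrow> real) \<Rightarrow> ennreal" where
  "emery_size M G T X =
     (SUP (n, \<tau>, k) \<in> {(n, \<tau>, k). simple_integrand M G n \<tau> k \<and>
                                 (\<forall>i<n. \<forall>\<omega>\<in>space M. \<bar>k i \<omega>\<bar> \<le> 1)}.
        sup_size M T (\<lambda>t \<omega>. X 0 \<omega> + simple_integral n \<tau> k X t \<omega>))"

definition emery_tendsto ::
    "'a measure \<Rightarrow> (real \<Rightarrow> 'a measure) \<Rightarrow> (nat \<Rightarrow> real \<Rightarrow> 'a \<Rightarrow> real) \<Rightarrow>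
     (real \<Rightarrow> 'a \<Rightarrow> real) \<Rightarrow> bool" where
  "emery_tendsto M G Xs X \<longleftrightarrow>
     (\<forall>T\<ge>0. (\<lambda>n. emery_size M G T (\<lambda>t \<omega>. Xs n t \<omega> - X t \<omega>)) \<longlonglongrightarrow> 0)"

section \<open>The stochastic integral\<close>

text \<open>
  \<open>bounded_integral M G S H X\<close>: \<open>X\<close> is (a version of) \<open>H \<bullet> S\<close> for a bounded predictable \<open>H\<close>. The
  integral on bounded predictable processes is the unique extension of the elementary one that obeys
  dominated convergence, with ucp convergence of the integrals; by the monotone class theorem its
  graph is the least set of pairs \<open>(H, X)\<close> that contains the elementary integrals and is closed under
  bounded pointwise limits of integrands. Integrals are over \<open>(0, t]\<close>, so \<open>H\<^sub>0\<close> is irrelevant and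
  \<open>(H \<bullet> S)\<^sub>0 = 0\<close>.
\<close>

inductive bounded_integral ::
    "'a measure \<Rightarrow> (real \<Rightarrow> 'a measure) \<Rightarrow> (real \<Rightarrow> 'a \<Rightarrow> 'b::euclidean_space) \<Rightarrow>
     (real \<Rightarrow> 'a \<Rightarrow> 'b) \<Rightarrow> (real \<Rightarrow> 'a \<Rightarrow> real) \<Rightarrow> bool"
  for M G S where
  simple: "\<lbrakk>simple_integrand M G n \<tau> h;
            \<And>t \<omega>. t > 0 \<Longrightarrow> \<omega> \<in> space M \<Longrightarrow> H t \<omega> = simple_process n \<tau> h t \<omega>\<rbrakk>
    \<Longrightarrow> bounded_integral M G S H (simple_integral n \<tau> h S)"
| limit: "\<lbrakk>\<And>n. bounded_integral M G S (Hs n) (Xs n);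
           \<And>n t \<omega>. t > 0 \<Longrightarrow> \<omega> \<in> space M \<Longrightarrow> norm (Hs n t \<omega>) \<le> c;
           \<And>t \<omega>. t > 0 \<Longrightarrow> \<omega> \<in> space M \<Longrightarrow> (\<lambda>n. Hs n t \<omega>) \<longlonglongrightarrow> H t \<omega>;
           cadlag_process M X;
           ucp_tendsto M Xs X\<rbrakk>
    \<Longrightarrow> bounded_integral M G S H X"

text \<open>
  A predictable \<open>H\<close> is \<open>S\<close>-integrable iff the integrals of \<open>H 1\<^bsub>{\<bar>H\<bar> \<le> n}\<^esub>\<close> converge in the
  semimartingale topology, and \<open>H \<bullet> S\<close> is then the limit. Truncating the norm of the whole vector
  \<open>H\<close>, and not its components, yields the vector stochastic integral.
\<close>

definition has_stochastic_integral ::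
    "'a measure \<Rightarrow> (real \<Rightarrow> 'a measure) \<Rightarrow> (real \<Rightarrow> 'a \<Rightarrow> 'b::euclidean_space) \<Rightarrow>
     (real \<Rightarrow> 'a \<Rightarrow> 'b) \<Rightarrow> (real \<Rightarrow> 'a \<Rightarrow> real) \<Rightarrow> bool" where
  "has_stochastic_integral M G S H V \<longleftrightarrow> predictable M G H \<and> cadlag_process M V \<and>
     (\<exists>Xs. (\<forall>n. bounded_integral M G S
                  (\<lambda>t \<omega>. if norm (H t \<omega>) \<le> real n then H t \<omega> else 0) (Xs n)) \<and>
           emery_tendsto M G Xs V)"

section \<open>Admissible strategies, (NA1) and expected utility\<close>

text \<open>\<open>V\<close> is a version of the integral process \<open>H \<bullet> S\<close>.\<close>

definition one_admissible ::
    "'a measure \<Rightarrow> (real \<Rightarrow> 'a measure) \<Rightarrow> (real \<Rightarrow> 'a \<Rightarrow> 'b::euclidean_space) \<Rightarrow>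
     (real \<Rightarrow> 'a \<Rightarrow> 'b) \<Rightarrow> (real \<Rightarrow> 'a \<Rightarrow> real) \<Rightarrow> bool" where
  "one_admissible M G S H V \<longleftrightarrow> has_stochastic_integral M G S H V \<and>
     (\<forall>t\<ge>0. measure M {\<omega> \<in> space M. V t \<omega> \<ge> -1} = 1)"

definition terminal_wealths ::
    "'a measure \<Rightarrow> (real \<Rightarrow> 'a measure) \<Rightarrow> (real \<Rightarrow> 'a \<Rightarrow> 'b::euclidean_space) \<Rightarrow>
     ('a \<Rightarrow> real) set" where
  "terminal_wealths M G S =
     {X \<in> borel_measurable M. \<exists>H V. one_admissible M G S H V \<and>
        (\<exists>L. (AE \<omega> in M. ((\<lambda>t. V t \<omega>) \<longlongrightarrow> L \<omega>) at_top) \<and> (AE \<omega> in M. X \<omega> = 1 + L \<omega>))}"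

definition NA1 ::
    "'a measure \<Rightarrow> (real \<Rightarrow> 'a measure) \<Rightarrow> (real \<Rightarrow> 'a \<Rightarrow> 'b::euclidean_space) \<Rightarrow> bool" where
  "NA1 M G S \<longleftrightarrow>
     ((\<lambda>m::real. SUP X\<in>terminal_wealths M G S. emeasure M {\<omega> \<in> space M. \<bar>X \<omega>\<bar> \<ge> m}) \<longlongrightarrow> 0) at_top"

text \<open>
  The extended-valued expectation \<open>E Y\<^sup>+ - E Y\<^sup>-\<close>; the Bochner integral would be \<open>0\<close> when \<open>E Y = \<infinity>\<close>.
\<close>

definition ext_expectation :: "'a measure \<Rightarrow> ('a \<Rightarrow> real) \<Rightarrow> ereal" where
  "ext_expectation M Y =
     enn2ereal (\<integral>\<^sup>+ \<omega>. ennreal (Y \<omega>) \<partial>M) - enn2ereal (\<integral>\<^sup>+ \<omega>. ennreal (- Y \<omega>) \<partial>M)"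

end

theory Submission
  imports Defs
begin

text \<open>
  Only two properties of the set \<open>K\<close> of terminal wealths matter: its elements are random variables,
  and they are almost surely nonnegative. If \<open>K\<close> is bounded in probability, choose \<open>m\<^sub>k \<ge> k\<close> with
  \<open>P(\<bar>X\<bar> \<ge> m\<^sub>k) \<le> 2\<^sup>-\<^sup>k\<close> for all \<open>X \<in> K\<close>; then \<open>U(x) = \<Sum>\<^sub>k 1(x \<ge> m\<^sub>k)\<close> has \<open>E U(X) \<le> 2\<close> on \<open>K\<close>.
  Conversely, Markov's inequality gives \<open>P(X \<ge> m) \<le> E U(X)\<^sup>+ / U(m)\<close>, and \<open>E U(X)\<^sup>+\<close> is bounded
  on \<open>K\<close> because \<open>U(X) \<ge> U(0)\<close>.
\<close>

text \<open>Monotonicity bounds \<open>U\<close> below by \<open>U 0\<close> on the half-line, so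
  unboundedness can only come from large values, and a level once exceeded stays exceeded.\<close>

lemma mono_on_unbounded_at_top:
  fixes U :: "real \<Rightarrow> real"
  assumes mono: "mono_on {0..} U" and unb: "\<not> bounded (U ` {0..})"
  shows "filterlim U at_top at_top"
  unfolding filterlim_at_top
proof
  fix Z :: real
  \<comment> \<open>Including \<open>\<bar>U 0\<bar>\<close> in the level makes it bound
    \<open>U\<close> from both sides if no such \<open>x\<close> exists: \<open>U 0\<close> is the
    lower bound.\<close>
  obtain x where x: "x \<ge> 0" "U x > max Z \<bar>U 0\<bar>"
  proof (rule ccontr)
    assume "\<not> thesis"
    then have le: "U x \<le> max Z \<bar>U 0\<bar>" if "x \<ge> 0" for x
      using that \<open>\<And>x. \<lbrakk>0 \<le> x; max Z \<bar>U 0\<bar> < U x\<rbrakk> \<Longrightarrow> thesis\<close> by force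
    have "\<bar>U x\<bar> \<le> max Z \<bar>U 0\<bar>" if "x \<ge> 0" for x
      using le[OF that] mono_onD[OF mono, of 0 x] that by auto
    then show False
      using unb by (auto simp: bounded_iff)
  qed
  have "Z \<le> U y" if "y \<ge> x" for y
    using mono_onD[OF mono, of x y] x that by auto
  then show "\<forall>\<^sub>F y in at_top. Z \<le> U y"
    by (auto simp: eventually_at_top_linorder)
qed

text \<open>The bound \<open>real k \<le> m k\<close> leaves only finitely many thresholds below
  each \<open>x\<close>. Finiteness matters for monotonicity too, since \<open>card\<close> of an
  infinite set is 0.\<close>

lemma mono_on_card_below:
  fixes m :: "nat \<Rightarrow> real"
  assumes m: "\<And>k. real k \<le> m k"
  shows "finite {k. m k \<le> x}"
    and "mono_on A (\<lambda>x. real (card {k. m k \<le> x}))"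
    and "\<not> bounded ((\<lambda>x. real (card {k. m k \<le> x})) ` {0..})"
proof -
  have fin: "finite {k. m k \<le> x}" for x
  proof (rule finite_subset)
    show "{k. m k \<le> x} \<subseteq> {k. real k \<le> x}"
      using m order_trans by blast
    show "finite {k. real k \<le> x}"
      by (rule finite_subset[of _ "{..nat \<lfloor>x\<rfloor>}"]) (auto simp: le_nat_floor)
  qed
  then show "finite {k. m k \<le> x}" .
  show "mono_on A (\<lambda>x. real (card {k. m k \<le> x}))"
    by (intro mono_onI of_nat_mono card_mono fin) auto
  show "\<not> bounded ((\<lambda>x. real (card {k. m k \<le> x})) ` {0..})"
  proof
    assume "bounded ((\<lambda>x. real (card {k. m k \<le> x})) ` {0..})"
    then obtain a where a: "\<And>x. x \<ge> 0 \<Longrightarrow> real (card {k. m k \<le> x}) \<le> a"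
      by (auto simp: bounded_iff)
    obtain n :: nat where n: "a < n"
      using reals_Archimedean2 by blast
    \<comment> \<open>The sequence \<open>m\<close> may fail to be increasing, so \<open>x\<close>
      is the largest of the first \<open>n + 1\<close> thresholds. All of them are then counted at
      \<open>x\<close>, more than \<open>a\<close> allows.\<close>
    define x where "x = Max (m ` {..<Suc n})"
    have le: "m k \<le> x" if "k < Suc n" for k
      unfolding x_def using that by (intro Max_ge) auto
    have "0 \<le> x"
      using le[of 0] m[of 0] by simp
    moreover have "card {..<Suc n} \<le> card {k. m k \<le> x}"
      using le by (intro card_mono fin) auto
    ultimately show False
      using a[of x] n by simp
  qed
qed

text \<open>The count is a sum of indicators of half-lines, and a series of nonnegative functions
  may be integrated term by term.\<close>

lemma nn_integral_card_below:
  fixes X :: "'a \<Rightarrow> real" and m :: "nat \<Rightarrow> real"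
  assumes [measurable]: "X \<in> borel_measurable M" and m: "\<And>k. real k \<le> m k"
  shows "(\<integral>\<^sup>+ \<omega>. ennreal (real (card {k. m k \<le> X \<omega>})) \<partial>M)
           = (\<Sum>k. emeasure M {\<omega> \<in> space M. m k \<le> X \<omega>})"
proof -
  have "ennreal (real (card {k. m k \<le> x})) = (\<Sum>k. indicator {m k..} x)" for x
  proof -
    have fin: "finite {k. m k \<le> x}"
      using m by (rule mono_on_card_below)
    have "(\<Sum>k. indicator {m k..} x :: ennreal) = (\<Sum>k\<in>{k. m k \<le> x}. indicator {m k..} x)"
      by (intro suminf_finite fin) auto
    then show ?thesis
      by (simp add: ennreal_of_nat_eq_real_of_nat)
  qed
  then have "(\<integral>\<^sup>+ \<omega>. ennreal (real (card {k. m k \<le> X \<omega>})) \<partial>M)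
      = (\<integral>\<^sup>+ \<omega>. (\<Sum>k. indicator {m k..} (X \<omega>)) \<partial>M)"
    by simp
  also have "\<dots> = (\<Sum>k. \<integral>\<^sup>+ \<omega>. indicator {m k..} (X \<omega>) \<partial>M)"
    by (intro nn_integral_suminf) simp
  also have "\<dots> = (\<Sum>k. emeasure M {\<omega> \<in> space M. m k \<le> X \<omega>})"
  proof (intro suminf_cong)
    fix k
    have "(\<integral>\<^sup>+ \<omega>. indicator {m k..} (X \<omega>) \<partial>M)
        = (\<integral>\<^sup>+ \<omega>. indicator {\<omega> \<in> space M. m k \<le> X \<omega>} \<omega> \<partial>M)"
      by (intro nn_integral_cong) (auto simp: indicator_def)
    then show "(\<integral>\<^sup>+ \<omega>. indicator {m k..} (X \<omega>) \<partial>M) = emeasure M {\<omega> \<in> space M. m k \<le> X \<omega>}"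
      by simp
  qed
  finally show ?thesis .
qed

text \<open>The tail bound is uniform over \<open>K\<close>, so one threshold sequence, and hence
  one \<open>U\<close>, serves every \<open>X\<close>. The geometric rate makes the tails
  summable.\<close>

proposition bounded_in_probability_imp_utility:
  fixes K :: "('a \<Rightarrow> real) set"
  assumes meas: "\<And>X. X \<in> K \<Longrightarrow> X \<in> borel_measurable M"
    and lim: "((\<lambda>m::real. SUP X\<in>K. emeasure M {\<omega> \<in> space M. \<bar>X \<omega>\<bar> \<ge> m}) \<longlongrightarrow> 0) at_top"
  shows "\<exists>U :: real \<Rightarrow> real. mono_on {0..} U \<and> \<not> bounded (U ` {0..}) \<and>
       (SUP X\<in>K. ext_expectation M (\<lambda>\<omega>. U (X \<omega>))) < \<infinity>"
proof -
  have "\<forall>k. \<exists>m. real k \<le> m \<and>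
      (SUP X\<in>K. emeasure M {\<omega> \<in> space M. \<bar>X \<omega>\<bar> \<ge> m}) < ennreal ((1/2)^k)"
  proof
    fix k
    \<comment> \<open>The tail bound holds for all large \<open>m\<close>, so it can be met together
      with \<open>real k \<le> m\<close>.\<close>
    have "\<forall>\<^sub>F m in at_top. (SUP X\<in>K. emeasure M {\<omega> \<in> space M. \<bar>X \<omega>\<bar> \<ge> m}) < ennreal ((1/2)^k)"
      by (rule order_tendstoD(2)[OF lim]) simp
    then have "\<forall>\<^sub>F m in at_top. real k \<le> m \<and>
        (SUP X\<in>K. emeasure M {\<omega> \<in> space M. \<bar>X \<omega>\<bar> \<ge> m}) < ennreal ((1/2)^k)"
      by (intro eventually_conj eventually_ge_at_top)
    then show "\<exists>m. real k \<le> m \<and>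
        (SUP X\<in>K. emeasure M {\<omega> \<in> space M. \<bar>X \<omega>\<bar> \<ge> m}) < ennreal ((1/2)^k)"
      by (rule eventually_happens'[OF trivial_limit_at_top_linorder])
  qed
  from choice[OF this] obtain m where m: "\<And>k. real k \<le> m k"
    and small: "\<And>k. (SUP X\<in>K. emeasure M {\<omega> \<in> space M. \<bar>X \<omega>\<bar> \<ge> m k}) < ennreal ((1/2)^k)"
    by blast
  define U where "U x = real (card {k. m k \<le> x})" for x
  have "ext_expectation M (\<lambda>\<omega>. U (X \<omega>)) \<le> 2" if "X \<in> K" for X
  proof -
    note [measurable] = meas[OF that]
    have le: "emeasure M {\<omega> \<in> space M. m k \<le> X \<omega>} \<le> ennreal ((1/2)^k)" for k
    proof -
      have "emeasure M {\<omega> \<in> space M. m k \<le> X \<omega>} \<le> emeasure M {\<omega> \<in> space M. \<bar>X \<omega>\<bar> \<ge> m k}"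
        by (intro emeasure_mono) auto
      also have "\<dots> \<le> (SUP X\<in>K. emeasure M {\<omega> \<in> space M. \<bar>X \<omega>\<bar> \<ge> m k})"
        using that by (rule SUP_upper)
      finally show ?thesis
        using small[of k] by simp
    qed
    have "(\<integral>\<^sup>+ \<omega>. ennreal (U (X \<omega>)) \<partial>M) = (\<Sum>k. emeasure M {\<omega> \<in> space M. m k \<le> X \<omega>})"
      unfolding U_def using m by (intro nn_integral_card_below) auto
    also have "\<dots> \<le> (\<Sum>k. ennreal ((1/2)^k))"
      using le by (intro suminf_le) auto
    \<comment> \<open>The geometric series starts at exponent 0.\<close>
    also have "\<dots> = 2"
      by (subst suminf_ennreal2) (auto simp: suminf_geometric)
    finally have "enn2ereal (\<integral>\<^sup>+ \<omega>. ennreal (U (X \<omega>)) \<partial>M) \<le> 2"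
      by (metis enn2ereal_numeral less_eq_ennreal.rep_eq)
    \<comment> \<open>Since \<open>U \<ge> 0\<close> and \<open>ennreal\<close> sends negative
      numbers to 0, the subtracted part of the extended expectation vanishes.\<close>
    moreover have "(\<integral>\<^sup>+ \<omega>. ennreal (- U (X \<omega>)) \<partial>M) = 0"
      by (simp add: U_def ennreal_neg)
    ultimately show ?thesis
      by (simp add: ext_expectation_def zero_ennreal.rep_eq)
  qed
  then have "(SUP X\<in>K. ext_expectation M (\<lambda>\<omega>. U (X \<omega>))) \<le> 2"
    by (rule SUP_least)
  also have "(2::ereal) < \<infinity>"
    by simp
  finally show ?thesis
    using mono_on_card_below(2,3)[OF m] unfolding U_def by blast
qed

text \<open>A bound on the difference of the two parts of the expectation becomes a bound on the
  positive part once the negative part is controlled by \<open>U 0\<close>. Markov's inequality at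
  level \<open>U m\<close> then gives tails of order \<open>1 / U m\<close>.\<close>

proposition utility_imp_bounded_in_probability:
  fixes K :: "('a \<Rightarrow> real) set" and U :: "real \<Rightarrow> real"
  assumes "prob_space M"
    and meas: "\<And>X. X \<in> K \<Longrightarrow> X \<in> borel_measurable M"
    and nonneg: "\<And>X. X \<in> K \<Longrightarrow> AE \<omega> in M. X \<omega> \<ge> 0"
    and mono: "mono_on {0..} U" and unb: "\<not> bounded (U ` {0..})"
    and fin: "(SUP X\<in>K. ext_expectation M (\<lambda>\<omega>. U (X \<omega>))) < \<infinity>"
  shows "((\<lambda>m::real. SUP X\<in>K. emeasure M {\<omega> \<in> space M. \<bar>X \<omega>\<bar> \<ge> m}) \<longlongrightarrow> 0) at_top"
proof -
  interpret prob_space M by fact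
  obtain B :: real where B: "(SUP X\<in>K. ext_expectation M (\<lambda>\<omega>. U (X \<omega>))) \<le> ereal B"
    \<comment> \<open>The supremum is \<open>-\<infinity>\<close> if \<open>K\<close> is empty; 0 is
      then an upper bound.\<close>
    using fin by (cases "SUP X\<in>K. ext_expectation M (\<lambda>\<omega>. U (X \<omega>))") (auto intro: that[of 0])
  \<comment> \<open>\<open>\<bar>B\<bar>\<close> bounds the expectation and
    \<open>\<bar>U 0\<bar>\<close> its negative part. The absolute values keep \<open>D\<close>
    nonnegative, so \<open>ennreal D\<close> does not truncate.\<close>
  define D where "D = \<bar>B\<bar> + \<bar>U 0\<bar>"
  have "0 \<le> D"
    by (simp add: D_def)
  have pos: "(\<integral>\<^sup>+ \<omega>. ennreal (U (X \<omega>)) \<partial>M) \<le> ennreal D" if "X \<in> K" for X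
  proof -
    let ?p = "\<integral>\<^sup>+ \<omega>. ennreal (U (X \<omega>)) \<partial>M" and ?n = "\<integral>\<^sup>+ \<omega>. ennreal (- U (X \<omega>)) \<partial>M"
    have "?n \<le> (\<integral>\<^sup>+ \<omega>. ennreal \<bar>U 0\<bar> \<partial>M)"
      using nonneg[OF that]
    proof (intro nn_integral_mono_AE, eventually_elim)
      fix \<omega> assume "0 \<le> X \<omega>"
      then show "ennreal (- U (X \<omega>)) \<le> ennreal \<bar>U 0\<bar>"
        using mono_onD[OF mono, of 0 "X \<omega>"] by (intro ennreal_leI) auto
    qed
    then have n: "?n \<le> ennreal \<bar>U 0\<bar>"
      by (simp add: emeasure_space_1)
    have "enn2ereal ?p - enn2ereal ?n \<le> ereal B"
      using SUP_upper[OF that] B unfolding ext_expectation_def by (rule order_trans)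
    moreover have "enn2ereal ?n \<le> ereal \<bar>U 0\<bar>"
      using n by (metis abs_ge_zero enn2ereal_ennreal less_eq_ennreal.rep_eq)
    \<comment> \<open>The negative part is finite, so an infinite positive part would make the
      difference infinite, against the bound \<open>B\<close>.\<close>
    ultimately have "enn2ereal ?p \<le> ereal D"
      using enn2ereal_nonneg[of ?n] unfolding D_def
      by (cases "enn2ereal ?p"; cases "enn2ereal ?n") auto
    then show ?thesis
      using \<open>0 \<le> D\<close> by (simp add: less_eq_ennreal.rep_eq)
  qed
  have markov: "(SUP X\<in>K. emeasure M {\<omega> \<in> space M. \<bar>X \<omega>\<bar> \<ge> m}) \<le> ennreal (D / U m)"
    if m: "m \<ge> 0" "U m > 0" for m
  proof (rule SUP_least)
    fix X assume X: "X \<in> K"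
    note [measurable] = meas[OF X]
    let ?A = "{\<omega> \<in> space M. \<bar>X \<omega>\<bar> \<ge> m}"
    have "ennreal (U m) * emeasure M ?A = (\<integral>\<^sup>+ \<omega>. ennreal (U m) * indicator ?A \<omega> \<partial>M)"
      by (simp add: nn_integral_cmult_indicator)
    also have "\<dots> \<le> (\<integral>\<^sup>+ \<omega>. ennreal (U (X \<omega>)) \<partial>M)"
      using nonneg[OF X]
    proof (intro nn_integral_mono_AE, eventually_elim)
      fix \<omega> assume "0 \<le> X \<omega>"
      \<comment> \<open>On \<open>?A\<close> nonnegativity of \<open>X \<omega>\<close> gives
        \<open>m \<le> X \<omega>\<close>, and monotonicity applies. Off \<open>?A\<close> the left
        side is 0, which is enough even where \<open>U (X \<omega>)\<close> is negative.\<close>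
      then show "ennreal (U m) * indicator ?A \<omega> \<le> ennreal (U (X \<omega>))"
        using mono_onD[OF mono, of m "X \<omega>"] m by (auto simp: indicator_def intro!: ennreal_leI)
    qed
    also have "\<dots> \<le> ennreal D"
      using X by (rule pos)
    finally have "U m * measure M ?A \<le> D"
      using m \<open>0 \<le> D\<close> by (simp add: emeasure_eq_measure flip: ennreal_mult)
    then show "emeasure M ?A \<le> ennreal (D / U m)"
      using m by (auto simp: emeasure_eq_measure field_simps intro!: ennreal_leI)
  qed
  have U: "filterlim U at_top at_top"
    using mono unb by (rule mono_on_unbounded_at_top)
  have lim: "((\<lambda>m. ennreal (D / U m)) \<longlongrightarrow> ennreal 0) at_top"
    by (intro tendsto_ennrealI tendsto_divide_0[OF tendsto_const] filterlim_at_top_imp_at_infinity U)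
  have le: "\<forall>\<^sub>F m in at_top.
      (SUP X\<in>K. emeasure M {\<omega> \<in> space M. \<bar>X \<omega>\<bar> \<ge> m}) \<le> ennreal (D / U m)"
    using eventually_ge_at_top[of 0] filterlim_at_top_dense[THEN iffD1, OF U, rule_format, of 0]
    by eventually_elim (rule markov)
  show ?thesis
    by (rule tendsto_sandwich[OF _ le tendsto_const lim[unfolded ennreal_0]]) simp
qed

text \<open>Admissibility gives one null set per time. Integer times are countably many, so their
  null sets combine into one, and they suffice to identify the limit.\<close>

lemma (in prob_space) terminal_wealths_nonneg:
  assumes "X \<in> terminal_wealths M G S"
  shows "AE \<omega> in M. X \<omega> \<ge> 0"
proof -
  obtain V :: "real \<Rightarrow> 'a \<Rightarrow> real" and L
    where V: "\<forall>t\<ge>0. measure M {\<omega> \<in> space M. V t \<omega> \<ge> -1} = 1"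
      and L: "AE \<omega> in M. ((\<lambda>t. V t \<omega>) \<longlongrightarrow> L \<omega>) at_top"
      and X: "AE \<omega> in M. X \<omega> = 1 + L \<omega>"
    using assms unfolding terminal_wealths_def one_admissible_def by blast
  have "AE \<omega> in M. V (real n) \<omega> \<ge> -1" for n
  proof -
    have one: "prob {\<omega> \<in> space M. V (real n) \<omega> \<ge> -1} = 1"
      using V by simp
    \<comment> \<open>A set outside the \<sigma>-algebra has \<open>measure\<close> 0 by convention,
      so probability 1 forces measurability.\<close>
    then have "{\<omega> \<in> space M. V (real n) \<omega> \<ge> -1} \<in> events"
      using measure_notin_sets by fastforce
    then have "AE \<omega> in M. \<omega> \<in> {\<omega> \<in> space M. V (real n) \<omega> \<ge> -1}"
      using one by (rule AE_in_set_eq_1[THEN iffD2])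
    then show ?thesis
      by eventually_elim simp
  qed
  then have "AE \<omega> in M. \<forall>n. V (real n) \<omega> \<ge> -1"
    by (simp add: AE_all_countable)
  with L X show ?thesis
  proof eventually_elim
    case (elim \<omega>)
    have "(\<lambda>n. V (real n) \<omega>) \<longlonglongrightarrow> L \<omega>"
      using elim(1) filterlim_real_sequentially by (rule filterlim_compose)
    then have "-1 \<le> L \<omega>"
      using elim(3) by (intro LIMSEQ_le_const) auto
    with elim show ?case by simp
  qed
qed

theorem lemma2p1:
  fixes M :: "'a measure"
    and G :: "real \<Rightarrow> 'a measure"
    and S :: "real \<Rightarrow> 'a \<Rightarrow> 'b::euclidean_space"
  assumes "prob_space M"
    and "filtration (space M) G"
    and "\<And>t. subalgebra M (G t)"
    and "semimartingale M G S"
  shows "NA1 M G S \<longleftrightarrow>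
    (\<exists>U :: real \<Rightarrow> real. mono_on {0..} U \<and> \<not> bounded (U ` {0..}) \<and>
       (SUP X\<in>terminal_wealths M G S. ext_expectation M (\<lambda>\<omega>. U (X \<omega>))) < \<infinity>)"
proof -
  have meas: "X \<in> borel_measurable M" if "X \<in> terminal_wealths M G S" for X
    using that by (simp add: terminal_wealths_def)
  note nonneg = prob_space.terminal_wealths_nonneg[OF assms(1)]
  show ?thesis
    unfolding NA1_def
  proof (rule iffI, goal_cases)
    case 1
    with meas show ?case
      by (rule bounded_in_probability_imp_utility)
  next
    case 2
    then obtain U :: "real \<Rightarrow> real" where "mono_on {0..} U" "\<not> bounded (U ` {0..})"
      "(SUP X\<in>terminal_wealths M G S. ext_expectation M (\<lambda>\<omega>. U (X \<omega>))) < \<infinity>"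
      by blast
    with assms(1) meas nonneg show ?case
      by (rule utility_imp_bounded_in_probability)
  qed
qed

end
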